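(* Let $d,L\ge1$, let $\mu,\alpha,\beta\in\Lambda_{d,L}$ with $\mu\subseteq\alpha$ and $\mu\subseteq\beta$, and let $(T,U)\in\mathrm{SCT}_{d,L}(\alpha/\mu)\times\mathrm{SCT}_{d,L}(\beta/\mu)$. Suppose that $(T,U)\mapsto(\tilde P,\tilde Q)$ via the growth diagram construction, and that $\mathrm{CRS}(T,U)=(P,Q)$, where $\mathrm{CRS}$ is the cylindric Robinson--Schensted map defined by iterated internal row insertion. Then $(\tilde P,\tilde Q)=(P,Q)$.
   Context: Cylindric shapes and tableaux. The cylinder is $\mathcal{C}_{d,L}=\mathbb{Z}^2/(-d,L)\mathbb{Z}$; its elements (cells) are classes $\langle i,j\rangle=(i,j)+(-d,L)\mathbb{Z}$, where $i$ is the row and $j$ the column; row indices may be taken modulo $d$ (with the corresponding column shift). A cylindric shape of period $(d,L)$ is a doubly infinite weakly decreasing integer sequence $\lambda=(\lambda_i)_{i\in\mathbb{Z}}$ with $\lambda_i=\lambda_{i+d}+L$ for all $i$. $\Lambda_{d,L}$ is the set of these. Its Young diagram is $Y_\lambda=\{\langle i,j\rangle: j\le\lambda_i\}$. Write $\mu\subseteq\lambda$ if $\mu_i\le\lambda_i$ for all $i$; then $Y_{\lambda/\mu}=Y_\lambda\setminus Y_\mu$, with cardinality $|\lambda/\mu|=\sum_{i=1}^d(\lambda_i-\mu_i)$. Adding a cell to row $i$ of a shape means increasing $\lambda_i$ by $1$ (and hence $\lambda_{i+kd}$ by $1$ for all $k\in\mathbb{Z}$). $\mathrm{SCT}_{d,L}(\lambda/\mu)$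 is the set of standard cylindric tableaux of shape $\lambda/\mu$: fillings of the cells of $Y_{\lambda/\mu}$ with $1,\dots,|\lambda/\mu|$, each used exactly once, increasing along rows (from $\langle i,j\rangle$ to $\langle i,j+1\rangle$) and columns (from $\langle i,j\rangle$ to $\langle i+1,j\rangle$); $\lambda$ and $\mu$ are the outer and inner shape. For such a tableau $T$ with $N=|\lambda/\mu|$ cells, $\mathrm{ssh}(T)=(\lambda^{(0)},\dots,\lambda^{(N)})$, where $\lambda^{(k)}$ is the outer shape of the tableau formed by the cells of $T$ with entries at most $k$ (so $\lambda^{(0)}=\mu$, $\lambda^{(N)}=\lambda$); $\mathrm{ssh}$ is injective. Internal row insertion. Let $T\in\mathrm{SCT}_{d,L}(\lambda/\mu)$, that is, $T$ is a filling of the cells of $Y_{\lambda/\mu}$ with $1,\dots,|\lambda/\mu|$, each used exactly once, increasing along rows and columns, and let $i\in[d]=\{1,\dots,d\}$ with $\mu_{i-1}>\mu_i$; the cell $\langle i,j\rangle$ with $j=\mu_i+1$ is called an inner corner of $T$. If $\langle i,j\rangle$ contains an entry $a$, remove this cell from $T$ (adding $1$ to $\mu_i$). Then insert $a$ into row $i+1$: if $a$ is larger than all entries of this row, place $a$ in a new cell at the end of row $i+1$ (adding $1$ to $\lambda_{i+1}$) and stop; otherwise let $a$ replace the smallest entry $a'$ of row $i+1$ with $a'>a$, and recursively insert $a'$ into row $i+2$, and so on (rows indexed modulo $d$). If $\langle i,j\rangle$ contains no entry (i.e. $\mu_i=\lambda_i$), simply add $1$ to both $\lambda_i$ and $\mu_i$.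 The result is the tableau $R_i(T)$. The map $\mathrm{CRS}$. Let $n=|\alpha/\mu|$, $m=|\beta/\mu|$. Given $(T,U)$, let $P_0=T$ and let $Q_0$ be the empty tableau of shape $\alpha/\alpha$. For $k=1,\dots,m$, let $\langle i,j\rangle$ be the cell of $U$ containing $k$ (it is an inner corner of $P_{k-1}$), let $P_k=R_i(P_{k-1})$, and let $Q_k$ be obtained from $Q_{k-1}$ by placing $k$ in the cell that is added to the outer shape of $P_{k-1}$ to obtain the outer shape of $P_k$. Then $\mathrm{CRS}(T,U)=(P_m,Q_m)$. Growth diagram construction. Consider the $m\times n$ grid with vertices $(x,y)$, $0\le x\le m$, $0\le y\le n$; each vertex is labeled by a shape $\rho^{(x,y)}\in\Lambda_{d,L}$. The left boundary labels $(\rho^{(0,0)},\dots,\rho^{(0,n)})$ are $\mathrm{ssh}(T)$ and the bottom boundary labels $(\rho^{(0,0)},\dots,\rho^{(m,0)})$ are $\mathrm{ssh}(U)$. The remaining labels are computed by the forward local rule: for each unit square with lower-left, upper-left, lower-right labels $\rho^{LL},\rho^{UL},\rho^{LR}$, the upper-right label $\rho^{UR}$ is: (F1) if $\rho^{UL}\ne\rho^{LR}$, then $\rho^{UR}_i=\max\{\rho^{UL}_i,\rho^{LR}_i\}$ for all $i$; (F2) if $\rho^{UL}=\rho^{LR}$, this shape is obtained from $\rho^{LL}$ by adding a cell to some row $i$, and $\rho^{UR}$ is obtained from $\rho^{UL}=\rho^{LR}$ by adding a cell to row $i+1$ (indices modulo $d$). Let $\lambda=\rho^{(m,n)}$. Then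 $\tilde P\in\mathrm{SCT}_{d,L}(\lambda/\beta)$ and $\tilde Q\in\mathrm{SCT}_{d,L}(\lambda/\alpha)$ are defined by $\mathrm{ssh}(\tilde P)=(\rho^{(m,0)},\dots,\rho^{(m,n)})$ and $\mathrm{ssh}(\tilde Q)=(\rho^{(0,n)},\dots,\rho^{(m,n)})$. *)

theory Defs
  imports Main
begin

section \<open>The cylinder and cylindric shapes\<close>

type_synonym shape = "int \<Rightarrow> int"
type_synonym cell = "(int \<times> int) set"

definition cyl_rel :: "int \<Rightarrow> int \<Rightarrow> ((int \<times> int) \<times> (int \<times> int)) set" where
  "cyl_rel d L = {((i, j), (i', j')). \<exists>k. i' = i - k * d \<and> j' = j + k * L}"

definition cell :: "int \<Rightarrow> int \<Rightarrow> int \<Rightarrow> int \<Rightarrow> cell" where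
  "cell d L i j = cyl_rel d L `` {(i, j)}"

definition shapes :: "int \<Rightarrow> int \<Rightarrow> shape set" where
  "shapes d L = {lam. antimono lam \<and> (\<forall>i. lam i = lam (i + d) + L)}"

definition young :: "int \<Rightarrow> int \<Rightarrow> shape \<Rightarrow> cell set" where
  "young d L lam = {cell d L i j | i j. j \<le> lam i}"

text \<open>Containment of shapes is the pointwise order \<open>\<le>\<close> on functions.\<close>

definition skew :: "int \<Rightarrow> int \<Rightarrow> shape \<Rightarrow> shape \<Rightarrow> cell set" where
  "skew d L lam \<mu> = young d L lam - young d L \<mu>"

definition skew_size :: "int \<Rightarrow> shape \<Rightarrow> shape \<Rightarrow> nat" where
  "skew_size d lam \<mu> = nat (\<Sum>i = 1..d. lam i - \<mu> i)"

definition add_cell :: "int \<Rightarrow> int \<Rightarrow> shape \<Rightarrow> shape" where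
  "add_cell d i lam = (\<lambda>r. if d dvd r - i then lam r + 1 else lam r)"

section \<open>Standard cylindric tableaux\<close>

text \<open>The two shapes are part of the data of a tableau: they are not determined by the
  filling (for instance, when the filling is empty).\<close>

record tableau =
  outer_shape :: shape
  inner_shape :: shape
  entry :: "cell \<Rightarrow> nat option"

definition SCT :: "int \<Rightarrow> int \<Rightarrow> shape \<Rightarrow> shape \<Rightarrow> tableau set" where
  "SCT d L lam \<mu> = {T. outer_shape T = lam \<and> inner_shape T = \<mu> \<and>
     dom (entry T) = skew d L lam \<mu> \<and>
     bij_betw (\<lambda>c. the (entry T c)) (skew d L lam \<mu>) {1..skew_size d lam \<mu>} \<and>
     (\<forall>i j a b. entry T (cell d L i j) = Some a \<and> entry T (cell d L i (j + 1)) = Some b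
        \<longrightarrow> a < b) \<and>
     (\<forall>i j a b. entry T (cell d L i j) = Some a \<and> entry T (cell d L (i + 1) j) = Some b
        \<longrightarrow> a < b)}"

definition num_cells :: "int \<Rightarrow> tableau \<Rightarrow> nat" where
  "num_cells d T = skew_size d (outer_shape T) (inner_shape T)"

definition sub_outer_shape :: "int \<Rightarrow> int \<Rightarrow> tableau \<Rightarrow> nat \<Rightarrow> shape" where
  "sub_outer_shape d L T k = (THE \<nu>. \<nu> \<in> shapes d L \<and> inner_shape T \<le> \<nu> \<and>
     skew d L \<nu> (inner_shape T) = {c. \<exists>a \<le> k. entry T c = Some a})"

definition ssh :: "int \<Rightarrow> int \<Rightarrow> tableau \<Rightarrow> shape list" where
  "ssh d L T = map (sub_outer_shape d L T) [0..<Suc (num_cells d T)]"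

section \<open>Internal row insertion\<close>

definition row_entries :: "int \<Rightarrow> int \<Rightarrow> tableau \<Rightarrow> int \<Rightarrow> nat set" where
  "row_entries d L T r = {a. \<exists>j. entry T (cell d L r j) = Some a}"

definition place_at_end :: "int \<Rightarrow> int \<Rightarrow> nat \<Rightarrow> int \<Rightarrow> tableau \<Rightarrow> tableau" where
  "place_at_end d L a r T = T\<lparr>outer_shape := add_cell d r (outer_shape T),
     entry := (entry T)(cell d L r (outer_shape T r + 1) \<mapsto> a)\<rparr>"

text \<open>For a standard tableau the recursion ends because the inserted entry strictly
  increases; for arbitrary fillings it need not end, hence the tail-recursive definition.
  The row index runs through the integers: \<open>cell\<close> and \<open>add_cell\<close> identify
  rows \<open>r\<close> and \<open>r + d\<close>.\<close>

partial_function (tailrec) row_insert ::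
  "int \<Rightarrow> int \<Rightarrow> nat \<Rightarrow> int \<Rightarrow> tableau \<Rightarrow> tableau" where
  "row_insert d L a r T =
     (if \<forall>b \<in> row_entries d L T r. b < a then place_at_end d L a r T
      else let a' = (LEAST b. b \<in> row_entries d L T r \<and> a < b);
               c = (THE c. (\<exists>j. c = cell d L r j) \<and> entry T c = Some a')
           in row_insert d L a' (r + 1) (T\<lparr>entry := (entry T)(c \<mapsto> a)\<rparr>))"

text \<open>Meaningful when row \<open>i\<close> has an inner corner, that is, when
  \<open>inner_shape T (i - 1) > inner_shape T i\<close>.\<close>

definition internal_insertion :: "int \<Rightarrow> int \<Rightarrow> int \<Rightarrow> tableau \<Rightarrow> tableau" where
  "internal_insertion d L i T =
     (let c = cell d L i (inner_shape T i + 1);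
          \<mu>' = add_cell d i (inner_shape T)
      in case entry T c of
           None \<Rightarrow> T\<lparr>outer_shape := add_cell d i (outer_shape T), inner_shape := \<mu>'\<rparr>
         | Some a \<Rightarrow> row_insert d L a (i + 1)
             (T\<lparr>inner_shape := \<mu>', entry := (entry T)(c := None)\<rparr>))"

section \<open>The cylindric Robinson--Schensted map\<close>

definition row_of :: "int \<Rightarrow> int \<Rightarrow> tableau \<Rightarrow> nat \<Rightarrow> int" where
  "row_of d L U k = (THE i. i \<in> {1..d} \<and> (\<exists>j. entry U (cell d L i j) = Some k))"

primrec CRS_upto :: "int \<Rightarrow> int \<Rightarrow> tableau \<Rightarrow> tableau \<Rightarrow> nat \<Rightarrow> tableau \<times> tableau" where
  "CRS_upto d L T U 0 =
     (T, \<lparr>outer_shape = outer_shape T, inner_shape = outer_shape T, entry = Map.empty\<rparr>)"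
| "CRS_upto d L T U (Suc k) =
     (let (P, Q) = CRS_upto d L T U k;
          P' = internal_insertion d L (row_of d L U (Suc k)) P;
          c = (THE c. c \<in> skew d L (outer_shape P') (outer_shape P))
      in (P', Q\<lparr>outer_shape := outer_shape P', entry := (entry Q)(c \<mapsto> Suc k)\<rparr>))"

definition CRS :: "int \<Rightarrow> int \<Rightarrow> tableau \<Rightarrow> tableau \<Rightarrow> tableau \<times> tableau" where
  "CRS d L T U = CRS_upto d L T U (num_cells d U)"

section \<open>The growth diagram construction\<close>

definition local_rule :: "int \<Rightarrow> shape \<Rightarrow> shape \<Rightarrow> shape \<Rightarrow> shape" where
  "local_rule d LL UL LR =
     (if UL \<noteq> LR then (\<lambda>i. max (UL i) (LR i))
      else add_cell d ((THE i. i \<in> {1..d} \<and> UL = add_cell d i LL) + 1) UL)"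

text \<open>The label of the vertex \<open>(x, y)\<close>, for \<open>x \<le> num_cells d U\<close> and
  \<open>y \<le> num_cells d T\<close>. At the origin both boundary conditions prescribe the common
  inner shape of \<open>T\<close> and \<open>U\<close>.\<close>

fun growth_label :: "int \<Rightarrow> int \<Rightarrow> tableau \<Rightarrow> tableau \<Rightarrow> nat \<Rightarrow> nat \<Rightarrow> shape" where
  "growth_label d L T U 0 y = ssh d L T ! y"
| "growth_label d L T U (Suc x) 0 = ssh d L U ! Suc x"
| "growth_label d L T U (Suc x) (Suc y) =
     local_rule d (growth_label d L T U x y) (growth_label d L T U x (Suc y))
       (growth_label d L T U (Suc x) y)"

definition growth_map :: "int \<Rightarrow> int \<Rightarrow> tableau \<Rightarrow> tableau \<Rightarrow> tableau \<times> tableau" where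
  "growth_map d L T U =
     (let m = num_cells d U; n = num_cells d T;
          \<rho> = growth_label d L T U;
          lam = \<rho> m n
      in (THE P. P \<in> SCT d L lam (outer_shape U) \<and> ssh d L P = map (\<lambda>y. \<rho> m y) [0..<Suc n],
          THE Q. Q \<in> SCT d L lam (outer_shape T) \<and> ssh d L Q = map (\<lambda>x. \<rho> x n) [0..<Suc m]))"

end

theory Submission
  imports Defs
begin

text \<open>A standard cylindric tableau is the same thing as a chain of shapes in which each shape
  arises from its predecessor by adding one cell: entry \<open>k + 1\<close> sits in the cell that the
  \<open>k\<close>-th step adds (\<open>tableau_of_chain_SCT\<close>, \<open>SCT_imp_chain\<close>). Since
  such a tableau is determined by its chain (\<open>SCT_determined_by_ssh\<close>), it suffices to show
  that the two tableaux built by iterated internal insertion have the right and the top boundary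
  of the growth diagram as their chains.

  The heart of the matter is a single column step. Let \<open>s 0, \<dots>, s n\<close> label one column of
  the diagram, let \<open>P\<close> be its tableau, and let \<open>s' 0, \<dots>, s' n\<close> label the next
  column. Every \<open>s' k\<close> is \<open>s k\<close> with one cell added, say to row \<open>b k\<close>.
  As long as the steps of \<open>s\<close> add cells outside this row, the local rule takes
  the maximum of two different labels, \<open>b\<close> stays constant, and both columns place the same entry in the same cell. When a step
  \<open>s k \<rightarrow> s (k + 1)\<close> adds a cell to row \<open>b k\<close>, the two labels coincide,
  the local rule raises \<open>b\<close> by one, and the entry \<open>k + 1\<close> occupies in the new column a cell one row further down.

  This is precisely a bumping path. An entry \<open>k + 1\<close> that is inserted into row
  \<open>b (k + 1)\<close> replaces the smallest larger entry of that row. That entry is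
  \<open>l + 1\<close>, where \<open>l\<close> is the first step after \<open>k\<close> at which \<open>s\<close> adds a cell
  to that row, i.e. the next step at which \<open>b\<close> changes. Halfway through the insertion,
  the entries below the one in hand have reached their places in the new column and those above
  it are still where the old column puts them. Read as an invariant, this stays true even when
  the path winds around the cylinder and meets a row repeatedly, which yields
  \<open>row_insert_eq_column\<close>. Iterating over the columns then identifies both
  recording devices: the cell added to the outer shape in the \<open>x\<close>-th insertion is the
  \<open>x\<close>-th step along the top boundary (\<open>CRS_upto_growth_label\<close>).\<close>

section \<open>Cells and shapes\<close>

locale cylinder =
  fixes d L :: int
  assumes d_pos: "1 \<le> d" and L_pos: "1 \<le> L"
begin

lemma shape_period: "lam \<in> shapes d L \<Longrightarrow> lam i = lam (i + d) + L"
  unfolding shapes_def by blast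

lemma shape_shift:
  assumes "lam \<in> shapes d L"
  shows "lam (i - k * d) = lam i + k * L"
proof (induction k rule: int_induct[where k = 0])
  case base
  show ?case by simp
next
  case (step1 k)
  have "lam (i - (k + 1) * d) = lam (i - (k + 1) * d + d) + L"
    using assms by (rule shape_period)
  with step1 show ?case by (simp add: algebra_simps)
next
  case (step2 k)
  have "lam (i - k * d) = lam (i - k * d + d) + L"
    using assms by (rule shape_period)
  with step2 show ?case by (simp add: algebra_simps)
qed

lemma shape_antimono: "lam \<in> shapes d L \<Longrightarrow> i \<le> i' \<Longrightarrow> lam i' \<le> lam i"
  unfolding shapes_def antimono_def by blast

lemma shapesI:
  assumes step: "\<And>i. lam (i + 1) \<le> lam i" and per: "\<And>i. lam i = lam (i + d) + L"
  shows "lam \<in> shapes d L"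
proof -
  have "lam i' \<le> lam i" if "i \<le> i'" for i i'
    using that
  proof (induction i' rule: int_ge_induct)
    case base
    show ?case by simp
  next
    case (step j)
    then show ?case using assms(1)[of j] by linarith
  qed
  then show ?thesis using per unfolding shapes_def antimono_def by blast
qed

lemma mem_cell_iff: "(x, y) \<in> cell d L i j \<longleftrightarrow> (\<exists>k. x = i - k * d \<and> y = j + k * L)"
  by (simp add: cell_def cyl_rel_def)

lemma cell_eq_iff:
  "cell d L i j = cell d L i' j' \<longleftrightarrow> (\<exists>k. i' = i - k * d \<and> j' = j + k * L)"
proof
  assume eq: "cell d L i j = cell d L i' j'"
  have "(i', j') \<in> cell d L i' j'"
    unfolding mem_cell_iff by (rule exI[of _ 0]) simp
  then show "\<exists>k. i' = i - k * d \<and> j' = j + k * L"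
    unfolding eq[symmetric] mem_cell_iff .
next
  assume "\<exists>k. i' = i - k * d \<and> j' = j + k * L"
  then obtain k where k: "i' = i - k * d" "j' = j + k * L" by blast
  have "(x, y) \<in> cell d L i j \<longleftrightarrow> (x, y) \<in> cell d L i' j'" for x y
  proof
    assume "(x, y) \<in> cell d L i j"
    then obtain l where "x = i - l * d" "y = j + l * L"
      unfolding mem_cell_iff by blast
    then show "(x, y) \<in> cell d L i' j'"
      unfolding mem_cell_iff by (intro exI[of _ "l - k"]) (simp add: k algebra_simps)
  next
    assume "(x, y) \<in> cell d L i' j'"
    then obtain l where "x = i' - l * d" "y = j' + l * L"
      unfolding mem_cell_iff by blast
    then show "(x, y) \<in> cell d L i j"
      unfolding mem_cell_iff by (intro exI[of _ "l + k"]) (simp add: k algebra_simps)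
  qed
  then show "cell d L i j = cell d L i' j'" by auto
qed

text \<open>The condition \<open>j \<le> lam i\<close> does not depend on the representative \<open>(i, j)\<close> of the
  cell, because the period of a shape matches the translation that defines the cylinder.\<close>

lemma cell_in_young:
  assumes "lam \<in> shapes d L"
  shows "cell d L i j \<in> young d L lam \<longleftrightarrow> j \<le> lam i"
proof
  assume "cell d L i j \<in> young d L lam"
  then show "j \<le> lam i"
    using shape_shift[OF assms, of i] by (auto simp: young_def cell_eq_iff)
qed (auto simp: young_def)

lemma cell_in_skew:
  assumes "lam \<in> shapes d L" "\<mu> \<in> shapes d L"
  shows "cell d L i j \<in> skew d L lam \<mu> \<longleftrightarrow> \<mu> i < j \<and> j \<le> lam i"
  using assms by (auto simp: skew_def cell_in_young)

lemma skew_obtain_cell: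
  assumes "c \<in> skew d L lam \<mu>"
  obtains i j where "c = cell d L i j"
  using assms by (auto simp: skew_def young_def)

text \<open>A shape is recovered from its diagram above a fixed inner shape; this is the uniqueness behind
  the definite description in \<open>sub_outer_shape\<close>.\<close>

lemma skew_inject:
  assumes "lam \<in> shapes d L" "\<nu> \<in> shapes d L" "\<mu> \<in> shapes d L" "\<mu> \<le> lam" "\<mu> \<le> \<nu>"
    and "skew d L lam \<mu> = skew d L \<nu> \<mu>"
  shows "lam = \<nu>"
proof
  fix i
  have "\<mu> i < j \<and> j \<le> lam i \<longleftrightarrow> \<mu> i < j \<and> j \<le> \<nu> i" for j
    using assms(6) cell_in_skew assms(1-3) by metis
  moreover have "\<mu> i \<le> lam i" "\<mu> i \<le> \<nu> i" using assms(4,5) by (auto simp: le_fun_def)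
  ultimately show "lam i = \<nu> i" by (metis order_le_less order_refl antisym)
qed

section \<open>Adding a cell\<close>

lemma add_cell_cong: "d dvd i - i' \<Longrightarrow> add_cell d i lam = add_cell d i' lam"
proof
  fix r
  assume "d dvd i - i'"
  then have "d dvd r - i \<longleftrightarrow> d dvd r - i'"
    using dvd_add_right_iff[of d "i - i'" "r - i"] by simp
  then show "add_cell d i lam r = add_cell d i' lam r" by (simp add: add_cell_def)
qed

lemma add_cell_eq_iff: "add_cell d i lam = add_cell d i' lam \<longleftrightarrow> d dvd i - i'"
proof
  assume "add_cell d i lam = add_cell d i' lam"
  then have "add_cell d i lam i = add_cell d i' lam i" by simp
  then show "d dvd i - i'" by (auto simp: add_cell_def split: if_splits)
qed (rule add_cell_cong)

lemma add_cell_ge: "lam \<le> add_cell d i lam"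
  by (auto simp: add_cell_def le_fun_def)

lemma add_cell_commute: "add_cell d i (add_cell d i' lam) = add_cell d i' (add_cell d i lam)"
  by (auto simp: add_cell_def)

text \<open>The two shapes extend a common one by cells in different rows, and their maximum is the union of
  the two diagrams; this is the local rule for different labels.\<close>

lemma max_add_cell:
  assumes "\<not> d dvd i - i'"
  shows "(\<lambda>r. max (add_cell d i lam r) (add_cell d i' lam r)) = add_cell d i (add_cell d i' lam)"
proof
  fix r
  have "\<not> (d dvd r - i \<and> d dvd r - i')"
    using assms dvd_diff[of d "r - i'" "r - i"] by auto
  then show "max (add_cell d i lam r) (add_cell d i' lam r) = add_cell d i (add_cell d i' lam) r"
    by (auto simp: add_cell_def)
qed

lemma max_shape:
  assumes "lam \<in> shapes d L" "\<nu> \<in> shapes d L"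
  shows "(\<lambda>r. max (lam r) (\<nu> r)) \<in> shapes d L"
proof (rule shapesI)
  fix i
  show "max (lam (i + 1)) (\<nu> (i + 1)) \<le> max (lam i) (\<nu> i)"
    using shape_antimono[OF assms(1), of i "i + 1"] shape_antimono[OF assms(2), of i "i + 1"]
    by auto
  have "lam i = lam (i + d) + L" "\<nu> i = \<nu> (i + d) + L"
    using assms by (auto intro: shape_period)
  then show "max (lam i) (\<nu> i) = max (lam (i + d)) (\<nu> (i + d)) + L" by auto
qed

lemma dvd_row_obtain:
  assumes "d dvd r - i"
  obtains k where "r = i - k * d"
proof -
  from assms obtain k where "r - i = d * k" by (auto simp: dvd_def)
  then show thesis using that[of "- k"] by (simp add: algebra_simps)
qed

text \<open>Only the rows congruent to \<open>i\<close> get longer, and each of them is strictly shorter than the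
  row above it by periodicity of the hypothesis.\<close>

lemma add_cell_shape:
  assumes lam: "lam \<in> shapes d L" and gt: "lam i < lam (i - 1)"
  shows "add_cell d i lam \<in> shapes d L"
proof (rule shapesI)
  fix r
  have per: "d dvd r + d - i \<longleftrightarrow> d dvd r - i"
    using dvd_add_right_iff[of d d "r - i"] by (simp add: algebra_simps)
  have "lam r = lam (r + d) + L" using lam by (rule shape_period)
  then show "add_cell d i lam r = add_cell d i lam (r + d) + L"
    using per by (simp add: add_cell_def)
  show "add_cell d i lam (r + 1) \<le> add_cell d i lam r"
  proof (cases "d dvd r + 1 - i")
    case True
    then obtain k where k: "r + 1 = i - k * d" by (rule dvd_row_obtain)
    then have "r = (i - 1) - k * d" by simp
    then have "lam r = lam (i - 1) + k * L" "lam (r + 1) = lam i + k * L"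
      using shape_shift[OF lam] k by metis+
    with gt have "lam (r + 1) < lam r" by simp
    then show ?thesis by (auto simp: add_cell_def)
  next
    case False
    then show ?thesis
      using shape_antimono[OF lam, of r "r + 1"] by (auto simp: add_cell_def)
  qed
qed

definition remove_cell :: "int \<Rightarrow> shape \<Rightarrow> shape" where
  "remove_cell i lam = (\<lambda>r. if d dvd r - i then lam r - 1 else lam r)"

lemma add_remove_cell: "add_cell d i (remove_cell i lam) = lam"
  by (auto simp: add_cell_def remove_cell_def)

lemma remove_cell_shape:
  assumes lam: "lam \<in> shapes d L" and gt: "lam (i + 1) < lam i"
  shows "remove_cell i lam \<in> shapes d L"
proof (rule shapesI)
  fix r
  have per: "d dvd r + d - i \<longleftrightarrow> d dvd r - i"
    using dvd_add_right_iff[of d d "r - i"] by (simp add: algebra_simps)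
  have "lam r = lam (r + d) + L" using lam by (rule shape_period)
  then show "remove_cell i lam r = remove_cell i lam (r + d) + L"
    using per by (simp add: remove_cell_def)
  show "remove_cell i lam (r + 1) \<le> remove_cell i lam r"
  proof (cases "d dvd r - i")
    case True
    then obtain k where k: "r = i - k * d" by (rule dvd_row_obtain)
    then have "r + 1 = (i + 1) - k * d" by simp
    then have "lam r = lam i + k * L" "lam (r + 1) = lam (i + 1) + k * L"
      using shape_shift[OF lam] k by metis+
    with gt have "lam (r + 1) < lam r" by simp
    then show ?thesis by (auto simp: remove_cell_def)
  next
    case False
    then show ?thesis
      using shape_antimono[OF lam, of r "r + 1"] by (auto simp: remove_cell_def)
  qed
qed

lemma ex1_row: "\<exists>!i'. i' \<in> {1..d} \<and> d dvd i' - i"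
proof
  let ?i = "(i - 1) mod d + 1"
  have "d dvd (i - 1) mod d - (i - 1)"
    using mod_eq_dvd_iff[of "(i - 1) mod d" d "i - 1"] by simp
  moreover have "0 \<le> (i - 1) mod d" "(i - 1) mod d < d" using d_pos by auto
  ultimately show "?i \<in> {1..d} \<and> d dvd ?i - i" by (auto simp: algebra_simps)
next
  fix j
  assume j: "j \<in> {1..d} \<and> d dvd j - i"
  then have "d dvd (j - 1) - (i - 1)" by simp
  then have "(j - 1) mod d = (i - 1) mod d" by (simp add: mod_eq_dvd_iff)
  moreover have "(j - 1) mod d = j - 1" using j by auto
  ultimately show "j = (i - 1) mod d + 1" by simp
qed

lemma sum_add_cell: "(\<Sum>r = 1..d. add_cell d i lam r) = (\<Sum>r = 1..d. lam r) + 1"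
proof -
  obtain i' where i': "i' \<in> {1..d}" "\<And>r. r \<in> {1..d} \<Longrightarrow> d dvd r - i \<longleftrightarrow> r = i'"
    using ex1_row[of i] by metis
  have "(\<Sum>r = 1..d. add_cell d i lam r) = (\<Sum>r = 1..d. lam r + (if r = i' then 1 else 0))"
    using i'(2) unfolding add_cell_def by (intro sum.cong) auto
  also have "\<dots> = (\<Sum>r = 1..d. lam r) + 1"
    using i' by (simp add: sum.distrib)
  finally show ?thesis .
qed

lemma cell_in_added:
  assumes "lam \<in> shapes d L" "add_cell d i lam \<in> shapes d L"
  shows "cell d L r j \<in> skew d L (add_cell d i lam) lam \<longleftrightarrow> d dvd r - i \<and> j = lam r + 1"
  using assms by (auto simp: cell_in_skew add_cell_def)

lemma skew_add_cell:
  assumes "lam \<in> shapes d L" "add_cell d i lam \<in> shapes d L"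
  shows "skew d L (add_cell d i lam) lam = {cell d L i (lam i + 1)}"
proof (intro equalityI subsetI)
  fix c
  assume c: "c \<in> skew d L (add_cell d i lam) lam"
  then obtain r j where rj: "c = cell d L r j" by (rule skew_obtain_cell)
  with c have "d dvd r - i" and j: "j = lam r + 1"
    using cell_in_added[OF assms] by auto
  then obtain k where "r = i - k * d" by (auto elim: dvd_row_obtain)
  then have "cell d L i (lam i + 1) = cell d L r j"
    using shape_shift[OF assms(1), of i k] j by (auto simp: cell_eq_iff)
  then show "c \<in> {cell d L i (lam i + 1)}" using rj by simp
next
  fix c
  assume "c \<in> {cell d L i (lam i + 1)}"
  then show "c \<in> skew d L (add_cell d i lam) lam"
    using cell_in_added[OF assms] by simp
qed

section \<open>Standard tableaux as chains of shapes\<close>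

definition chain :: "(nat \<Rightarrow> shape) \<Rightarrow> nat \<Rightarrow> bool" where
  "chain s n \<longleftrightarrow> (\<forall>k\<le>n. s k \<in> shapes d L) \<and> (\<forall>k<n. \<exists>i. s (Suc k) = add_cell d i (s k))"

text \<open>The condition on \<open>entry\<close> also forces it to be undefined outside the cells of the chain,
  so that the whole record is determined. A predicate is used instead of a function from chains
  to tableaux because the steps of an insertion are compared with a chain entry by entry.\<close>

definition tableau_of_chain :: "(nat \<Rightarrow> shape) \<Rightarrow> nat \<Rightarrow> tableau \<Rightarrow> bool" where
  "tableau_of_chain s n T \<longleftrightarrow> outer_shape T = s n \<and> inner_shape T = s 0 \<and>
     (\<forall>c a. entry T c = Some a \<longleftrightarrow> (\<exists>k<n. a = Suc k \<and> c \<in> skew d L (s (Suc k)) (s k)))"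

lemma chain_shape: "chain s n \<Longrightarrow> k \<le> n \<Longrightarrow> s k \<in> shapes d L"
  by (auto simp: chain_def)

lemma chain_step:
  assumes "chain s n" "k < n"
  obtains i where "s (Suc k) = add_cell d i (s k)"
  using assms by (auto simp: chain_def)

lemma chain_mono:
  assumes "chain s n" "k \<le> l" "l \<le> n"
  shows "s k i \<le> s l i"
  using assms(2,3)
proof (induction l rule: dec_induct)
  case base
  show ?case by simp
next
  case (step l)
  then obtain r where "s (Suc l) = add_cell d r (s l)"
    using chain_step[OF assms(1), of l] by auto
  then have "s l i \<le> s (Suc l) i" by (auto simp: add_cell_def)
  then show ?case using step by linarith
qed

text \<open>A cell that has been added belongs to all later shapes, so it is not added twice.\<close>

lemma chain_skew_eqI:
  assumes "chain s n" "k < n" "l < n"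
    "c \<in> skew d L (s (Suc k)) (s k)" "c \<in> skew d L (s (Suc l)) (s l)"
  shows "k = l"
proof -
  from assms(4) obtain i j where c: "c = cell d L i j" by (rule skew_obtain_cell)
  have "s k i < j" "j \<le> s (Suc k) i" "s l i < j" "j \<le> s (Suc l) i"
    using assms c by (auto simp: cell_in_skew chain_shape)
  moreover have "s (Suc k) i \<le> s l i" if "k < l"
    using that assms by (intro chain_mono[OF assms(1)]) auto
  moreover have "s (Suc l) i \<le> s k i" if "l < k"
    using that assms by (intro chain_mono[OF assms(1)]) auto
  ultimately show ?thesis by linarith
qed

lemma chain_step_cell:
  assumes "chain s n" "k < n"
  shows "\<exists>c. skew d L (s (Suc k)) (s k) = {c}"
  using assms skew_add_cell[of "s k"] chain_shape[OF assms(1), of k]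
    chain_shape[OF assms(1), of "Suc k"]
  by (metis Suc_leI chain_step less_imp_le)

lemma chain_skew_Union:
  assumes "chain s n" "m \<le> n"
  shows "skew d L (s m) (s 0) = (\<Union>k<m. skew d L (s (Suc k)) (s k))"
  using assms(2)
proof (induction m)
  case 0
  show ?case by (simp add: skew_def)
next
  case (Suc m)
  have le: "s 0 i \<le> s m i" "s m i \<le> s (Suc m) i" for i
    using chain_mono[OF assms(1)] Suc.prems by auto
  have "cell d L i j \<in> skew d L (s (Suc m)) (s 0) \<longleftrightarrow>
      cell d L i j \<in> skew d L (s m) (s 0) \<or> cell d L i j \<in> skew d L (s (Suc m)) (s m)" for i j
    using le[of i] Suc.prems by (auto simp: cell_in_skew chain_shape[OF assms(1)])
  then have "skew d L (s (Suc m)) (s 0) = skew d L (s m) (s 0) \<union> skew d L (s (Suc m)) (s m)"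
    by (blast elim: skew_obtain_cell)
  then show ?case using Suc by (auto simp: lessThan_Suc)
qed

lemma chain_size:
  assumes "chain s n"
  shows "skew_size d (s n) (s 0) = n"
proof -
  have "(\<Sum>i = 1..d. s m i - s 0 i) = int m" if "m \<le> n" for m
    using that
  proof (induction m)
    case 0
    show ?case by simp
  next
    case (Suc m)
    then obtain i where "s (Suc m) = add_cell d i (s m)"
      using chain_step[OF assms, of m] by auto
    then show ?case using Suc sum_add_cell[of i "s m"] by (simp add: sum_subtractf)
  qed
  then show ?thesis by (simp add: skew_size_def)
qed

lemma tableau_of_chain_cong:
  assumes "\<And>k. k \<le> n \<Longrightarrow> s k = s' k"
  shows "tableau_of_chain s n T \<longleftrightarrow> tableau_of_chain s' n T"
proof -
  have "s (Suc k) = s' (Suc k)" "s k = s' k" if "k < n" for k using that assms by auto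
  then show ?thesis by (simp add: tableau_of_chain_def assms cong: conj_cong)
qed

lemma tableau_of_chain_num_cells:
  "chain s n \<Longrightarrow> tableau_of_chain s n T \<Longrightarrow> num_cells d T = n"
  by (simp add: num_cells_def tableau_of_chain_def chain_size)

lemma tableau_of_chain_unique:
  assumes "tableau_of_chain s n T" "tableau_of_chain s' n T'" "\<And>k. k \<le> n \<Longrightarrow> s k = s' k"
  shows "T = T'"
proof -
  have "entry T c = Some a \<longleftrightarrow> entry T' c = Some a" for c a
    using assms by (auto simp: tableau_of_chain_def)
  then have "entry T c = entry T' c" for c by (metis option.exhaust)
  then have "entry T = entry T'" by auto
  then show ?thesis using assms by (auto simp: tableau_of_chain_def)
qed

text \<open>Every shape that contains a cell contains the cells to its left and above it. Hence these
  neighbours are added no later than the cell itself; they are not added in the same step because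
  they are different cells, for which \<open>L \<ge> 1\<close> matters when \<open>d = 1\<close> and a cell and the
  one above it lie in the same row of the cylinder.\<close>

lemma tableau_of_chain_SCT:
  assumes ch: "chain s n" and T: "tableau_of_chain s n T"
  shows "T \<in> SCT d L (s n) (s 0)"
proof -
  have ent: "entry T c = Some a \<longleftrightarrow> (\<exists>k<n. a = Suc k \<and> c \<in> skew d L (s (Suc k)) (s k))" for c a
    using T by (auto simp: tableau_of_chain_def)
  have dom: "dom (entry T) = skew d L (s n) (s 0)"
    unfolding chain_skew_Union[OF ch order_refl] by (auto simp: dom_def ent)
  have "inj_on (\<lambda>c. the (entry T c)) (dom (entry T))"
  proof (rule inj_onI)
    fix c c'
    assume "c \<in> dom (entry T)" "c' \<in> dom (entry T)" "the (entry T c) = the (entry T c')"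
    then obtain a where "entry T c = Some a" "entry T c' = Some a" by auto
    then obtain k where "k < n" "c \<in> skew d L (s (Suc k)) (s k)" "c' \<in> skew d L (s (Suc k)) (s k)"
      by (auto simp: ent)
    then show "c = c'" using chain_step_cell[OF ch, of k] by auto
  qed
  moreover have "(\<lambda>c. the (entry T c)) ` dom (entry T) = {1..n}"
  proof (intro equalityI subsetI)
    fix a
    assume "a \<in> {1..n}"
    then obtain k where k: "k < n" "a = Suc k" by (cases a) auto
    then obtain c where "c \<in> skew d L (s (Suc k)) (s k)"
      using chain_step_cell[OF ch, of k] by auto
    then have "entry T c = Some a" using k by (auto simp: ent)
    then show "a \<in> (\<lambda>c. the (entry T c)) ` dom (entry T)"
      by (auto simp: dom_def intro!: image_eqI[of _ _ c])
  next
    fix a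
    assume "a \<in> (\<lambda>c. the (entry T c)) ` dom (entry T)"
    then obtain c where "entry T c = Some a" by auto
    then show "a \<in> {1..n}" by (auto simp: ent)
  qed
  ultimately have bij: "bij_betw (\<lambda>c. the (entry T c)) (skew d L (s n) (s 0))
      {1..skew_size d (s n) (s 0)}"
    using dom chain_size[OF ch] by (simp add: bij_betw_def)
  have row: "a < b"
    if ab: "entry T (cell d L i j) = Some a" "entry T (cell d L i (j + 1)) = Some b" for i j a b
  proof (rule ccontr)
    assume "\<not> a < b"
    moreover obtain k where k: "a = Suc k" "k < n" "cell d L i j \<in> skew d L (s (Suc k)) (s k)"
      using ab(1) unfolding ent by blast
    moreover obtain l where l: "b = Suc l" "l < n"
        "cell d L i (j + 1) \<in> skew d L (s (Suc l)) (s l)"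
      using ab(2) unfolding ent by blast
    ultimately have kl: "l \<le> k" "k < n" "s k i < j" "j + 1 \<le> s (Suc l) i"
      by (auto simp: cell_in_skew chain_shape[OF ch])
    then have "s (Suc l) i \<le> s (Suc k) i" by (intro chain_mono[OF ch]) auto
    moreover obtain r where "s (Suc k) = add_cell d r (s k)"
      using kl by (auto elim: chain_step[OF ch])
    then have "s (Suc k) i \<le> s k i + 1" by (auto simp: add_cell_def)
    ultimately show False using kl by linarith
  qed
  have col: "a < b"
    if ab: "entry T (cell d L i j) = Some a" "entry T (cell d L (i + 1) j) = Some b" for i j a b
  proof (rule ccontr)
    assume "\<not> a < b"
    moreover obtain k where k: "a = Suc k" "k < n" "cell d L i j \<in> skew d L (s (Suc k)) (s k)"
      using ab(1) unfolding ent by blast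
    moreover obtain l where l: "b = Suc l" "l < n"
        "cell d L (i + 1) j \<in> skew d L (s (Suc l)) (s l)"
      using ab(2) unfolding ent by blast
    ultimately have kl: "l \<le> k" "k < n" "cell d L i j \<in> skew d L (s (Suc k)) (s k)"
        "cell d L (i + 1) j \<in> skew d L (s (Suc l)) (s l)"
      by auto
    then have sk: "s k i < j" "j \<le> s (Suc l) (i + 1)"
      by (auto simp: cell_in_skew chain_shape[OF ch])
    show False
    proof (cases "l = k")
      case True
      then have "cell d L i j = cell d L (i + 1) j"
        using kl chain_step_cell[OF ch, of k] by auto
      then show False using L_pos by (auto simp: cell_eq_iff)
    next
      case False
      then have "s (Suc l) (i + 1) \<le> s k (i + 1)" using kl by (intro chain_mono[OF ch]) auto
      moreover have "s k (i + 1) \<le> s k i"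
        using shape_antimono[OF chain_shape[OF ch, of k], of i "i + 1"] kl by simp
      ultimately show False using sk by linarith
    qed
  qed
  have "outer_shape T = s n" "inner_shape T = s 0" using T by (auto simp: tableau_of_chain_def)
  then show ?thesis
    unfolding SCT_def mem_Collect_eq using dom bij row col by blast
qed

lemma tableau_of_chain_ssh:
  assumes ch: "chain s n" and T: "tableau_of_chain s n T"
  shows "ssh d L T = map s [0..<Suc n]"
proof -
  have ent: "entry T c = Some a \<longleftrightarrow> (\<exists>k<n. a = Suc k \<and> c \<in> skew d L (s (Suc k)) (s k))" for c a
    using T by (auto simp: tableau_of_chain_def)
  have inner: "inner_shape T = s 0" using T by (auto simp: tableau_of_chain_def)
  have "sub_outer_shape d L T k = s k" if k: "k \<le> n" for k
  proof -
    have "(\<exists>a\<le>k. entry T c = Some a) \<longleftrightarrow> (\<exists>l<k. c \<in> skew d L (s (Suc l)) (s l))" for c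
      unfolding ent using k by (metis Suc_le_eq less_le_trans)
    then have sk: "skew d L (s k) (s 0) = {c. \<exists>a\<le>k. entry T c = Some a}"
      unfolding chain_skew_Union[OF ch k] by auto
    have le: "s 0 \<le> s k" using chain_mono[OF ch _ k] by (auto simp: le_fun_def)
    show ?thesis unfolding sub_outer_shape_def inner
    proof (rule the_equality)
      show "s k \<in> shapes d L \<and> s 0 \<le> s k \<and> skew d L (s k) (s 0) = {c. \<exists>a\<le>k. entry T c = Some a}"
        using sk le chain_shape[OF ch k] by simp
    next
      fix \<nu>
      assume "\<nu> \<in> shapes d L \<and> s 0 \<le> \<nu> \<and> skew d L \<nu> (s 0) = {c. \<exists>a\<le>k. entry T c = Some a}"
      then show "\<nu> = s k"
        using sk le chain_shape[OF ch] k by (intro skew_inject[of _ _ "s 0"]) auto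
    qed
  qed
  then show ?thesis
    using tableau_of_chain_num_cells[OF ch T] by (auto simp: ssh_def)
qed

lemma ssh_nth:
  assumes "chain s n" "tableau_of_chain s n T" "k \<le> n"
  shows "ssh d L T ! k = s k"
  using assms(3) nth_map_upt[of k "Suc n" 0 s] tableau_of_chain_ssh[OF assms(1,2)]
  by (simp del: upt_Suc)

lemma tableau_of_chain_extend:
  assumes ch: "chain s (Suc n)" and T: "tableau_of_chain s n T"
    and c: "c \<in> skew d L (s (Suc n)) (s n)"
  shows "tableau_of_chain s (Suc n)
    (T\<lparr>outer_shape := s (Suc n), entry := (entry T)(c \<mapsto> Suc n)\<rparr>)"
proof -
  have ent: "entry T c = Some a \<longleftrightarrow> (\<exists>k<n. a = Suc k \<and> c \<in> skew d L (s (Suc k)) (s k))" for c a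
    using T by (auto simp: tableau_of_chain_def)
  have only: "skew d L (s (Suc n)) (s n) = {c}"
    using chain_step_cell[OF ch, of n] c by auto
  have "c \<notin> skew d L (s (Suc k)) (s k)" if "k < n" for k
    using chain_skew_eqI[OF ch, of k n c] c that by auto
  then have "((entry T)(c \<mapsto> Suc n)) c' = Some a \<longleftrightarrow>
      (\<exists>k<Suc n. a = Suc k \<and> c' \<in> skew d L (s (Suc k)) (s k))" for c' a
    using only by (auto simp: ent less_Suc_eq)
  then show ?thesis using T by (simp add: tableau_of_chain_def)
qed

text \<open>The cell of the largest entry has no cell of the tableau to its right or below it. It is
  therefore a corner of the outer shape, and removing it leaves a smaller standard tableau, whose
  chain is extended by the original outer shape.\<close>

lemma SCT_imp_chain:
  assumes "lam \<in> shapes d L" "\<mu> \<in> shapes d L" "\<mu> \<le> lam"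
    and "T \<in> SCT d L lam \<mu>" "skew_size d lam \<mu> = n"
  shows "\<exists>s. chain s n \<and> tableau_of_chain s n T"
  using assms(1,3-)
proof (induction n arbitrary: lam T)
  case 0
  then have "skew d L lam \<mu> = {}" by (auto simp: SCT_def bij_betw_def)
  moreover have "skew d L \<mu> \<mu> = {}" by (simp add: skew_def)
  ultimately have "lam = \<mu>"
    using 0 assms(2) by (intro skew_inject[of _ _ \<mu>]) auto
  with 0 \<open>skew d L lam \<mu> = {}\<close> have "tableau_of_chain (\<lambda>_. \<mu>) 0 T"
    by (auto simp: tableau_of_chain_def SCT_def dom_def)
  then show ?case using assms(2) by (intro exI[of _ "\<lambda>_. \<mu>"]) (auto simp: chain_def)
next
  case (Suc n)
  note lam = \<open>lam \<in> shapes d L\<close>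
  have out: "outer_shape T = lam" "inner_shape T = \<mu>" "dom (entry T) = skew d L lam \<mu>"
    and bij: "bij_betw (\<lambda>c. the (entry T c)) (skew d L lam \<mu>) {1..Suc n}"
    and row: "\<And>i j a b. entry T (cell d L i j) = Some a \<Longrightarrow>
       entry T (cell d L i (j + 1)) = Some b \<Longrightarrow> a < b"
    and col: "\<And>i j a b. entry T (cell d L i j) = Some a \<Longrightarrow>
       entry T (cell d L (i + 1) j) = Some b \<Longrightarrow> a < b"
    using Suc.prems(3)[unfolded SCT_def mem_Collect_eq Suc.prems(4)] by blast+
  have bound: "\<exists>a\<le>Suc n. entry T c = Some a" if "c \<in> skew d L lam \<mu>" for c
  proof -
    have "c \<in> dom (entry T)" using that out(3) by simp
    moreover have "the (entry T c) \<in> {1..Suc n}" using bij_betwE[OF bij] that by blast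
    ultimately show ?thesis by auto
  qed
  have "Suc n \<in> (\<lambda>c. the (entry T c)) ` skew d L lam \<mu>" using bij by (simp add: bij_betw_def)
  then obtain c where c: "c \<in> skew d L lam \<mu>" "the (entry T c) = Suc n" by auto
  then have entc: "entry T c = Some (Suc n)" using bound[of c] by auto
  from c(1) obtain i j where cij: "c = cell d L i j" by (rule skew_obtain_cell)
  with c have j: "\<mu> i < j" "j \<le> lam i" using lam assms(2) by (auto simp: cell_in_skew)
  \<comment> \<open>A cell of the tableau in either place would contain an entry above the maximum.\<close>
  have notin: "cell d L i (j + 1) \<notin> skew d L lam \<mu>" "cell d L (i + 1) j \<notin> skew d L lam \<mu>"
    using bound row[of i j "Suc n"] col[of i j "Suc n"] entc cij by fastforce+
  have jlam: "j = lam i" using notin(1) j lam assms(2) by (auto simp: cell_in_skew)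
  have "\<mu> (i + 1) \<le> \<mu> i" using shape_antimono[OF assms(2), of i "i + 1"] by simp
  then have gt: "lam (i + 1) < lam i"
    using notin(2) j jlam lam assms(2) by (auto simp: cell_in_skew)
  define lam' where "lam' = remove_cell i lam"
  have lam': "lam' \<in> shapes d L" and add: "lam = add_cell d i lam'"
    using remove_cell_shape[OF lam gt] by (auto simp: lam'_def add_remove_cell)
  have le': "\<mu> \<le> lam'"
  proof (rule le_funI)
    fix r
    show "\<mu> r \<le> lam' r"
    proof (cases "d dvd r - i")
      case True
      then obtain k where "r = i - k * d" by (rule dvd_row_obtain)
      then have "\<mu> r < lam r"
        using shape_shift[OF lam, of i k] shape_shift[OF assms(2), of i k] j by simp
      then show ?thesis by (simp add: lam'_def remove_cell_def)
    next
      case False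
      then show ?thesis using Suc.prems by (simp add: lam'_def remove_cell_def le_fun_def)
    qed
  qed
  have skc: "skew d L lam lam' = {c}"
  proof -
    have "lam' i + 1 = j" by (simp add: lam'_def remove_cell_def jlam)
    then show ?thesis using skew_add_cell[OF lam', of i, folded add] lam cij by simp
  qed
  have sk': "skew d L lam' \<mu> = skew d L lam \<mu> - {c}"
  proof -
    have "lam' \<le> lam" using add_cell_ge[of lam' i] unfolding add[symmetric] .
    then have "young d L lam' \<subseteq> young d L lam" by (fastforce simp: young_def le_fun_def intro: order_trans)
    moreover have "young d L lam - young d L lam' = {c}" using skc by (simp add: skew_def)
    ultimately show ?thesis by (auto simp: skew_def)
  qed
  have size': "skew_size d lam' \<mu> = n"
    using Suc.prems(4) sum_add_cell[of i lam', folded add] by (simp add: skew_size_def sum_subtractf)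
  define T' where "T' = T\<lparr>outer_shape := lam', entry := (entry T)(c := None)\<rparr>"
  have ent': "entry T' x = Some a \<longleftrightarrow> x \<noteq> c \<and> entry T x = Some a" for x a
    by (auto simp: T'_def)
  have bij': "bij_betw (\<lambda>x. the (entry T' x)) (skew d L lam' \<mu>) {1..n}"
  proof -
    have "bij_betw (\<lambda>x. the (entry T x)) (skew d L lam \<mu> - {c}) ({1..Suc n} - {Suc n})"
      using bij_betw_DiffI[OF bij, of "{c}" "{Suc n}"] c by (auto simp: bij_betw_def)
    moreover have "{1..Suc n} - {Suc n} = {1..n}" by auto
    ultimately have "bij_betw (\<lambda>x. the (entry T x)) (skew d L lam' \<mu>) {1..n}" using sk' by simp
    then show ?thesis by (rule bij_betw_cong[THEN iffD1, rotated]) (auto simp: sk' T'_def)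
  qed
  have "T' \<in> SCT d L lam' \<mu>"
    unfolding SCT_def mem_Collect_eq
  proof (intro conjI allI impI)
    show "outer_shape T' = lam'" "inner_shape T' = \<mu>" using out by (auto simp: T'_def)
    show "dom (entry T') = skew d L lam' \<mu>" using out sk' by (simp add: T'_def)
    show "bij_betw (\<lambda>x. the (entry T' x)) (skew d L lam' \<mu>) {1..skew_size d lam' \<mu>}"
      using bij' size' by simp
  next
    fix i j a b
    assume "entry T' (cell d L i j) = Some a \<and> entry T' (cell d L i (j + 1)) = Some b"
    then show "a < b" using row ent' by blast
  next
    fix i j a b
    assume "entry T' (cell d L i j) = Some a \<and> entry T' (cell d L (i + 1) j) = Some b"
    then show "a < b" using col ent' by blast
  qed
  from Suc.IH[OF lam' le' this size'] obtain s
    where s: "chain s n" "tableau_of_chain s n T'" by blast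
  define s' where "s' = s(Suc n := lam)"
  have sn: "s n = lam'" using s by (simp add: tableau_of_chain_def T'_def)
  have "chain s' (Suc n)"
    using s(1) lam add[folded sn] by (auto simp: chain_def s'_def less_Suc_eq le_Suc_eq)
  moreover have "tableau_of_chain s' n T'"
    using s(2) by (subst tableau_of_chain_cong[of n s' s]) (auto simp: s'_def)
  moreover have "c \<in> skew d L (s' (Suc n)) (s' n)"
    using skc sn by (simp add: s'_def)
  ultimately have "tableau_of_chain s' (Suc n)
      (T'\<lparr>outer_shape := s' (Suc n), entry := (entry T')(c \<mapsto> Suc n)\<rparr>)"
    by (intro tableau_of_chain_extend)
  moreover have "T'\<lparr>outer_shape := s' (Suc n), entry := (entry T')(c \<mapsto> Suc n)\<rparr> = T"
    using out(1) fun_upd_triv[of "entry T" c] by (simp add: T'_def s'_def entc)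
  ultimately show ?case using \<open>chain s' (Suc n)\<close> by auto
qed

lemma SCT_determined_by_ssh:
  assumes ch: "chain s n" and T: "tableau_of_chain s n T"
  shows "(THE P. P \<in> SCT d L (s n) (s 0) \<and> ssh d L P = map s [0..<Suc n]) = T"
proof (rule the_equality)
  show "T \<in> SCT d L (s n) (s 0) \<and> ssh d L T = map s [0..<Suc n]"
    using tableau_of_chain_SCT[OF assms] tableau_of_chain_ssh[OF assms] by simp
next
  fix P
  assume P: "P \<in> SCT d L (s n) (s 0) \<and> ssh d L P = map s [0..<Suc n]"
  have "s 0 \<le> s n" using chain_mono[OF ch] by (auto simp: le_fun_def)
  then obtain t where t: "chain t n" "tableau_of_chain t n P"
    using SCT_imp_chain[of "s n" "s 0" P n] P chain_size[OF ch] chain_shape[OF ch] by auto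
  then have "map t [0..<Suc n] = map s [0..<Suc n]"
    using tableau_of_chain_ssh P by auto
  then have "\<forall>k\<in>set [0..<Suc n]. t k = s k" unfolding map_eq_conv .
  moreover have "k \<in> set [0..<Suc n]" if "k \<le> n" for k using that by auto
  ultimately have "t k = s k" if "k \<le> n" for k using that by blast
  then show "P = T" by (rule tableau_of_chain_unique[OF t(2) T])
qed

section \<open>One column of the growth diagram\<close>

text \<open>This turns the two cases of the local rule into one recursion for the row of the additional
  cell. The representative in \<open>{1..d}\<close> that the rule picks for equal labels may differ from
  \<open>b\<close>, but only by a multiple of \<open>d\<close>, which does not affect the shape.\<close>

lemma local_rule_add_cell:
  "local_rule d lam (add_cell d i lam) (add_cell d b lam) =
     add_cell d (if d dvd i - b then b + 1 else b) (add_cell d i lam)"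
proof (cases "d dvd i - b")
  case True
  obtain i' where i': "i' \<in> {1..d}" "d dvd i' - i"
    and uniq: "\<And>j. j \<in> {1..d} \<Longrightarrow> d dvd j - i \<Longrightarrow> j = i'"
    using ex1_row[of i] by metis
  have "add_cell d i lam = add_cell d j lam \<longleftrightarrow> d dvd j - i" for j
    by (simp add: add_cell_eq_iff dvd_diff_commute)
  then have "(THE j. j \<in> {1..d} \<and> add_cell d i lam = add_cell d j lam) = i'"
    using i' by (intro the_equality) (blast intro: uniq)+
  moreover have "d dvd (i' + 1) - (b + 1)"
    using dvd_add[OF i'(2) True] by simp
  ultimately show ?thesis
    using True add_cell_cong[OF True] add_cell_cong[of "i' + 1" "b + 1"]
    by (simp add: local_rule_def)
next
  case False
  then show ?thesis
    using max_add_cell[of i b lam] add_cell_commute[of i b lam]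
    by (simp add: local_rule_def add_cell_eq_iff)
qed

text \<open>The cell just added to row \<open>i\<close> leaves room in row \<open>i + 1\<close>. For \<open>d = 1\<close> both are
  the same row of the cylinder, and the room comes from \<open>L \<ge> 1\<close> instead.\<close>

lemma add_cell_below_shape:
  assumes "lam \<in> shapes d L" "add_cell d i lam \<in> shapes d L"
  shows "add_cell d (i + 1) (add_cell d i lam) \<in> shapes d L"
proof (rule add_cell_shape[OF assms(2)])
  show "add_cell d i lam (i + 1) < add_cell d i lam (i + 1 - 1)"
  proof (cases "d = 1")
    case True
    then show ?thesis using shape_period[OF assms(2), of i] L_pos by simp
  next
    case False
    then have "\<not> d dvd 1" using d_pos by auto
    then show ?thesis
      using shape_antimono[OF assms(1), of i "i + 1"] by (simp add: add_cell_def)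
  qed
qed

end

text \<open>The labels of a column are \<open>s\<close>, whose \<open>k\<close>-th step adds a cell to row \<open>r k\<close>; the
  labels of the next column have an additional cell in row \<open>b k\<close>. The rows are arbitrary
  integers that count only modulo \<open>d\<close>: not reducing them keeps the recursion for \<open>b\<close> free
  of case distinctions at the end of a period.\<close>

locale growth_column = cylinder +
  fixes s :: "nat \<Rightarrow> shape" and r b :: "nat \<Rightarrow> int" and n :: nat
  assumes s_shape: "k \<le> n \<Longrightarrow> s k \<in> shapes d L"
    and s_Suc: "k < n \<Longrightarrow> s (Suc k) = add_cell d (r k) (s k)"
    and b_Suc: "k < n \<Longrightarrow> b (Suc k) = (if d dvd r k - b k then b k + 1 else b k)"
    and start: "add_cell d (b 0) (s 0) \<in> shapes d L"
begin

definition s' :: "nat \<Rightarrow> shape" where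
  "s' k = add_cell d (b k) (s k)"

lemma s'_local_rule: "k < n \<Longrightarrow> s' (Suc k) = local_rule d (s k) (s (Suc k)) (s' k)"
  by (simp add: s'_def s_Suc b_Suc local_rule_add_cell)

lemma s'_shape: "k \<le> n \<Longrightarrow> s' k \<in> shapes d L"
proof (induction k)
  case 0
  show ?case using start by (simp add: s'_def)
next
  case (Suc k)
  then have k: "k < n" "s k \<in> shapes d L" "s (Suc k) \<in> shapes d L" "s' k \<in> shapes d L"
    using s_shape by auto
  show ?case
  proof (cases "d dvd r k - b k")
    case True
    then have "s (Suc k) = s' k" using k by (simp add: s_Suc s'_def add_cell_eq_iff)
    then show ?thesis
      using True k add_cell_below_shape[of "s k" "b k"] by (simp add: s'_def b_Suc)
  next
    case False
    then have "s (Suc k) \<noteq> s' k" using k by (simp add: s_Suc s'_def add_cell_eq_iff)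
    then show ?thesis
      using s'_local_rule[OF k(1)] max_shape[OF k(3,4)] by (simp add: local_rule_def)
  qed
qed

text \<open>When both edges use the same row, \<open>s' k\<close> and \<open>s (Suc k)\<close> coincide and the new cell goes
  below; otherwise the step of \<open>s\<close> is repeated on top of the additional cell.\<close>

lemma s'_Suc:
  assumes "k < n"
  shows "s' (Suc k) = add_cell d (if d dvd r k - b k then b k + 1 else r k) (s' k)"
proof (cases "d dvd r k - b k")
  case True
  then show ?thesis using assms by (simp add: s'_def b_Suc s_Suc add_cell_cong)
next
  case False
  then show ?thesis using assms by (simp add: s'_def b_Suc s_Suc add_cell_commute)
qed

lemma chain_s: "chain s n"
  using s_shape s_Suc by (auto simp: chain_def)

lemma chain_s': "chain s' n"
  using s'_shape s'_Suc by (auto simp: chain_def)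

lemma step_row:
  assumes "k < n"
  shows "cell d L i j \<in> skew d L (s (Suc k)) (s k) \<longleftrightarrow> d dvd i - r k \<and> j = s k i + 1"
  using assms cell_in_added[of "s k" "r k"] s_shape[of k] s_shape[of "Suc k"] by (simp add: s_Suc)

lemma step_unmoved:
  assumes k: "k < n" and no: "\<not> d dvd r k - b k"
  shows "skew d L (s' (Suc k)) (s' k) = skew d L (s (Suc k)) (s k)"
proof -
  have "s' k (r k) = s k (r k)" using no by (simp add: s'_def add_cell_def)
  then show ?thesis
    using k no s'_Suc[OF k] s'_shape[of k] s'_shape[of "Suc k"] s_shape[of k] s_shape[of "Suc k"]
    by (simp add: s_Suc skew_add_cell)
qed

text \<open>Since \<open>s' k = s (Suc k)\<close> here, the length of the row in which the moved entry arrives can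
  be measured in \<open>s\<close>, which is where row insertion sees it.\<close>

lemma step_moved:
  assumes k: "k < n" and bump: "d dvd r k - b k"
  shows "skew d L (s' (Suc k)) (s' k) = {cell d L (b (Suc k)) (s (Suc k) (b (Suc k)) + 1)}"
proof -
  have "s' k = s (Suc k)" using k bump by (simp add: s_Suc s'_def add_cell_eq_iff dvd_diff_commute)
  then show ?thesis
    using k bump s'_Suc[OF k] s'_shape[of "Suc k"] s_shape[of "Suc k"]
    by (simp add: b_Suc skew_add_cell)
qed

text \<open>What allows an insertion to jump from one bump to the next: the steps in between leave no trace
  in the row of the additional cell and place the same entries in both columns.\<close>

lemma quiet_interval:
  assumes "k \<le> m" "m \<le> n" "\<And>l. k \<le> l \<Longrightarrow> l < m \<Longrightarrow> \<not> d dvd r l - b k"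
  shows "b m = b k" and "s m (b k) = s k (b k)"
    and "\<And>l. k \<le> l \<Longrightarrow> l < m \<Longrightarrow>
      skew d L (s' (Suc l)) (s' l) = skew d L (s (Suc l)) (s l)"
proof -
  have *: "b l = b k \<and> s l (b k) = s k (b k)" if "k \<le> l" "l \<le> m" for l
    using that
  proof (induction l rule: dec_induct)
    case base
    show ?case by simp
  next
    case (step l)
    then have "l < n" "\<not> d dvd r l - b k" using assms(2,3) by auto
    moreover from this have "\<not> d dvd b k - r l" by (simp add: dvd_diff_commute)
    ultimately show ?case using step by (simp add: b_Suc s_Suc add_cell_def)
  qed
  then show "b m = b k" "s m (b k) = s k (b k)" using *[of m] assms(1) by blast+
  show "skew d L (s' (Suc l)) (s' l) = skew d L (s (Suc l)) (s l)" if "k \<le> l" "l < m" for l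
  proof (rule step_unmoved)
    show "l < n" using that assms(2) by simp
    show "\<not> d dvd r l - b l" using *[of l] assms(3)[of l] that by simp
  qed
qed

section \<open>Row insertion follows the growth diagram\<close>

text \<open>The state of an insertion in which \<open>k + 1\<close> has been bumped and not yet been placed: smaller
  entries are in their cells in the new column, larger ones in their cells in the old column.
  The inner shape has already been enlarged, the outer shape has not.\<close>

definition partly_bumped :: "nat \<Rightarrow> tableau \<Rightarrow> bool" where
  "partly_bumped k T \<longleftrightarrow> outer_shape T = s n \<and> inner_shape T = s' 0 \<and>
     (\<forall>c a. entry T c = Some a \<longleftrightarrow> (\<exists>l<n. l \<noteq> k \<and> a = Suc l \<and>
        c \<in> (if l < k then skew d L (s' (Suc l)) (s' l) else skew d L (s (Suc l)) (s l))))"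

text \<open>The entries larger than \<open>k + 1\<close> in the row \<open>b (k + 1)\<close> belong to the later steps of \<open>s\<close>
  in this row. If there are none, the end of the row is the cell that the new column assigns to
  \<open>k + 1\<close>. Otherwise the first such step \<open>l\<close> yields the bumped entry. As \<open>s\<close> does not change
  in this row between the steps \<open>k\<close> and \<open>l\<close>, the cell of \<open>l + 1\<close> in the old column is the cell
  of \<open>k + 1\<close> in the new one, and the entries strictly between need not move. So the state after
  the replacement is the same one with \<open>l\<close> in place of \<open>k\<close>.\<close>

lemma row_insert_eq_column:
  assumes "k < n" "d dvd r k - b k" "partly_bumped k T"
  shows "tableau_of_chain s' n (row_insert d L (Suc k) (b (Suc k)) T)"
  using assms
proof (induction "n - k" arbitrary: k T rule: less_induct)
  case less
  note k = \<open>k < n\<close> \<open>d dvd r k - b k\<close>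
  let ?row = "b (Suc k)"
  have ent: "entry T c = Some a \<longleftrightarrow> (\<exists>l<n. l \<noteq> k \<and> a = Suc l \<and>
        c \<in> (if l < k then skew d L (s' (Suc l)) (s' l) else skew d L (s (Suc l)) (s l)))" for c a
    using less.prems(3) unfolding partly_bumped_def by blast
  have out: "outer_shape T = s n" "inner_shape T = s' 0"
    using less.prems(3) by (auto simp: partly_bumped_def)
  \<comment> \<open>Larger entries are still placed by \<open>s\<close>, so their rows are given by \<open>r\<close>.\<close>
  have row: "Suc l \<in> row_entries d L T ?row \<longleftrightarrow> d dvd r l - ?row" if "k < l" "l < n" for l
    using that by (auto simp: row_entries_def ent step_row dvd_diff_commute)
  have row_range: "\<exists>l<n. l \<noteq> k \<and> a = Suc l" if "a \<in> row_entries d L T ?row" for a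
    using that by (auto simp: row_entries_def ent)
  show ?case
  proof (cases "\<exists>l. k < l \<and> l < n \<and> d dvd r l - ?row")
    case False
    then have quiet: "\<not> d dvd r l - ?row" if "Suc k \<le> l" "l < n" for l using that by auto
    have "a < Suc k" if "a \<in> row_entries d L T ?row" for a
      using row_range[OF that] that row False by (metis Suc_less_eq linorder_neqE_nat)
    then have "row_insert d L (Suc k) ?row T = place_at_end d L (Suc k) ?row T"
      by (subst row_insert.simps) auto
    note q = quiet_interval[of "Suc k" n, OF _ order_refl quiet]
    let ?c = "cell d L ?row (s n ?row + 1)"
    have moved: "skew d L (s' (Suc k)) (s' k) = {?c}"
      using step_moved[OF k] q(2) k by simp
    have "((entry T)(?c \<mapsto> Suc k)) x = Some a \<longleftrightarrow>
        (\<exists>l<n. a = Suc l \<and> x \<in> skew d L (s' (Suc l)) (s' l))" for x a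
    proof -
      have same: "(if l < k then skew d L (s' (Suc l)) (s' l) else skew d L (s (Suc l)) (s l)) =
          skew d L (s' (Suc l)) (s' l)" if "l \<noteq> k" "l < n" for l
        using that q(3)[of l] k by simp
      have "entry T x = Some a \<longleftrightarrow> (\<exists>l<n. l \<noteq> k \<and> a = Suc l \<and> x \<in> skew d L (s' (Suc l)) (s' l))"
        unfolding ent using same by blast
      moreover have "l = k" if "l < n" "?c \<in> skew d L (s' (Suc l)) (s' l)" for l
        using chain_skew_eqI[OF chain_s' that(1) k(1) that(2)] moved by simp
      ultimately show ?thesis using moved k by auto
    qed
    moreover have "add_cell d ?row (s n) = s' n"
      using q(1) k by (simp add: s'_def)
    ultimately show ?thesis
      unfolding \<open>row_insert d L (Suc k) ?row T = place_at_end d L (Suc k) ?row T\<close>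
      by (simp add: tableau_of_chain_def place_at_end_def out)
  next
    case True
    define l where "l = (LEAST l. k < l \<and> l < n \<and> d dvd r l - ?row)"
    have l: "k < l" "l < n" "d dvd r l - ?row"
      using LeastI_ex[OF True] by (auto simp: l_def)
    have quiet: "\<not> d dvd r m - ?row" if "Suc k \<le> m" "m < l" for m
      using not_less_Least[of m "\<lambda>l. k < l \<and> l < n \<and> d dvd r l - ?row"] that l
      by (auto simp: l_def)
    have Suc_k_l: "Suc k \<le> l" using l by simp
    note q = quiet_interval[OF Suc_k_l less_imp_le[OF l(2)] quiet]
    have least: "(LEAST a. a \<in> row_entries d L T ?row \<and> Suc k < a) = Suc l"
    proof (rule Least_equality)
      show "Suc l \<in> row_entries d L T ?row \<and> Suc k < Suc l" using row l by simp
    next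
      fix a
      assume a: "a \<in> row_entries d L T ?row \<and> Suc k < a"
      then obtain m where "m < n" "a = Suc m" using row_range by blast
      then show "Suc l \<le> a" using a row[of m] quiet[of m] by (cases "m < l") auto
    qed
    let ?c = "cell d L ?row (s l ?row + 1)"
    have skew_l: "skew d L (s (Suc l)) (s l) = {?c}"
      using step_row[OF l(2), of ?row "s l ?row + 1"] l chain_step_cell[OF chain_s l(2)]
      by (auto simp: dvd_diff_commute)
    have moved: "skew d L (s' (Suc k)) (s' k) = {?c}"
      using step_moved[OF k] q(2) by simp
    have ent_l: "entry T x = Some (Suc l) \<longleftrightarrow> x = ?c" for x
      using l by (auto simp: ent skew_l)
    have the_c: "(THE c. (\<exists>j. c = cell d L ?row j) \<and> entry T c = Some (Suc l)) = ?c"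
      by (rule the_equality) (auto simp: ent_l)
    define T' where "T' = T\<lparr>entry := (entry T)(?c \<mapsto> Suc k)\<rparr>"
    have "Suc l \<in> row_entries d L T ?row" using row l by simp
    then have not_end: "\<not> (\<forall>a\<in>row_entries d L T ?row. a < Suc k)"
      using l(1) by (intro notI) (drule bspec, assumption, simp)
    have ins: "row_insert d L (Suc k) ?row T = row_insert d L (Suc l) (?row + 1) T'"
      unfolding row_insert.simps[of d L "Suc k" ?row T] if_not_P[OF not_end]
      by (simp only: Let_def least the_c T'_def)
    have "entry T' x = Some a \<longleftrightarrow> (\<exists>m<n. m \<noteq> l \<and> a = Suc m \<and>
        x \<in> (if m < l then skew d L (s' (Suc m)) (s' m) else skew d L (s (Suc m)) (s m)))"
      (is "_ \<longleftrightarrow> (\<exists>m<n. m \<noteq> l \<and> a = Suc m \<and> x \<in> ?new m)") for x a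
    proof -
      have same: "(if m < k then skew d L (s' (Suc m)) (s' m) else skew d L (s (Suc m)) (s m)) = ?new m"
        if "m \<noteq> k" for m
        using that q(3)[of m] l by auto
      have old: "entry T x = Some a \<longleftrightarrow>
          (\<exists>m<n. m \<noteq> k \<and> a = Suc m \<and> x \<in> ?new m)"
        unfolding ent using same by blast
      have new_k: "?new k = {?c}" using moved l by simp
      show ?thesis
      proof (cases "x = ?c")
        case True
        have hit: "entry T' x = Some (Suc k)" by (simp add: T'_def True)
        have "m = k" if "m < n" "m \<noteq> l" "x \<in> ?new m" for m
        proof (rule ccontr)
          assume "m \<noteq> k"
          then have "entry T x = Some (Suc m)"
            unfolding ent using same[of m] that by auto
          then show False using ent_l[of x] True that by simp
        qed
        moreover have "x \<in> ?new k" using new_k True by simp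
        moreover have "k \<noteq> l" using l(1) by simp
        ultimately have "(\<exists>m<n. m \<noteq> l \<and> a = Suc m \<and> x \<in> ?new m) \<longleftrightarrow> a = Suc k"
          using k(1) by blast
        then show ?thesis unfolding hit option.inject by blast
      next
        case False
        then have "entry T' x = entry T x" by (simp add: T'_def)
        moreover have "\<not> (x \<in> ?new k)" "\<not> (x \<in> ?new l)" using False new_k skew_l by auto
        ultimately show ?thesis using old by metis
      qed
    qed
    then have "partly_bumped l T'" by (simp add: partly_bumped_def T'_def out)
    moreover have "d dvd r l - b l" "b (Suc l) = ?row + 1"
      using l q(1) by (simp_all add: b_Suc)
    ultimately show ?thesis
      using less.hyps[of l T'] l ins by simp
  qed
qed

text \<open>The cell at the inner corner is filled by the first step of \<open>s\<close> in row \<open>b 0\<close>, so removing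
  its entry starts the bumping path. If no step uses this row, the cell is empty and
  the additional cell stays in row \<open>b 0\<close> along the whole column.\<close>

lemma internal_insertion_eq_column:
  assumes P: "tableau_of_chain s n P"
  shows "tableau_of_chain s' n (internal_insertion d L (b 0) P)"
proof -
  let ?row = "b 0"
  have ent: "entry P c = Some a \<longleftrightarrow> (\<exists>k<n. a = Suc k \<and> c \<in> skew d L (s (Suc k)) (s k))" for c a
    using P unfolding tableau_of_chain_def by blast
  have out: "outer_shape P = s n" "inner_shape P = s 0"
    using P by (auto simp: tableau_of_chain_def)
  let ?c = "cell d L ?row (s 0 ?row + 1)"
  show ?thesis
  proof (cases "\<exists>l. l < n \<and> d dvd r l - ?row")
    case False
    note q = quiet_interval[of 0 n]
    have quiet: "\<And>l. 0 \<le> l \<Longrightarrow> l < n \<Longrightarrow> \<not> d dvd r l - ?row" using False by auto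
    have "entry P ?c = None"
    proof (rule ccontr)
      assume "entry P ?c \<noteq> None"
      then obtain l where "l < n" "?c \<in> skew d L (s (Suc l)) (s l)" by (auto simp: ent)
      then show False using quiet[of l] by (auto simp: step_row dvd_diff_commute)
    qed
    moreover have "add_cell d ?row (s n) = s' n" "add_cell d ?row (s 0) = s' 0"
      using q(1)[OF _ _ quiet] by (simp_all add: s'_def)
    moreover have "skew d L (s' (Suc l)) (s' l) = skew d L (s (Suc l)) (s l)" if "l < n" for l
      using q(3)[OF _ _ quiet] that by simp
    ultimately show ?thesis
      by (auto simp: internal_insertion_def Let_def out ent tableau_of_chain_def)
  next
    case True
    define l where "l = (LEAST l. l < n \<and> d dvd r l - ?row)"
    have l: "l < n" "d dvd r l - ?row"
      using LeastI_ex[OF True] by (auto simp: l_def)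
    have quiet: "\<not> d dvd r m - ?row" if "0 \<le> m" "m < l" for m
      using not_less_Least[of m "\<lambda>l. l < n \<and> d dvd r l - ?row"] that l
      by (auto simp: l_def)
    note q = quiet_interval[OF le0 less_imp_le[OF l(1)] quiet]
    have skew_l: "skew d L (s (Suc l)) (s l) = {?c}"
      using step_row[OF l(1), of ?row "s l ?row + 1"] l chain_step_cell[OF chain_s l(1)] q(2)
      by (auto simp: dvd_diff_commute)
    have ent_l: "entry P x = Some (Suc l) \<longleftrightarrow> x = ?c" for x
      using l by (auto simp: ent skew_l)
    define P' where "P' = P\<lparr>inner_shape := s' 0, entry := (entry P)(?c := None)\<rparr>"
    have "entry P' x = Some a \<longleftrightarrow> x \<noteq> ?c \<and> entry P x = Some a" for x a by (simp add: P'_def)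
    also have "x \<noteq> ?c \<and> entry P x = Some a \<longleftrightarrow> entry P x = Some a \<and> a \<noteq> Suc l" for x a
      using ent_l[of x] by auto
    also have "entry P x = Some a \<and> a \<noteq> Suc l \<longleftrightarrow> (\<exists>m<n. m \<noteq> l \<and> a = Suc m \<and>
        x \<in> (if m < l then skew d L (s' (Suc m)) (s' m) else skew d L (s (Suc m)) (s m)))" for x a
      using q(3) by (auto simp: ent)
    finally have "partly_bumped l P'"
      unfolding partly_bumped_def by (simp add: P'_def out)
    moreover have "d dvd r l - b l" "b (Suc l) = ?row + 1"
      using l q(1) by (simp_all add: b_Suc)
    ultimately have "tableau_of_chain s' n (row_insert d L (Suc l) (?row + 1) P')"
      using row_insert_eq_column[OF l(1)] by metis
    moreover have "internal_insertion d L ?row P = row_insert d L (Suc l) (?row + 1) P'"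
      using ent_l[of ?c] by (simp add: internal_insertion_def Let_def out P'_def s'_def)
    ultimately show ?thesis by simp
  qed
qed

end

section \<open>Iterated insertion and the growth diagram\<close>

context cylinder
begin

text \<open>The column step with the rows \<open>r\<close> and \<open>b\<close> eliminated: \<open>w\<close> is any column that satisfies
  the local rule along \<open>s\<close>. The last conclusion makes the step from \<open>s n\<close> to \<open>w n\<close> available as
  a step of the top boundary.\<close>

lemma internal_insertion_column:
  assumes ch: "chain s n" and P: "tableau_of_chain s n P"
    and w0: "w 0 = add_cell d i (s 0)" "w 0 \<in> shapes d L"
    and w: "\<And>y. y < n \<Longrightarrow> w (Suc y) = local_rule d (s y) (s (Suc y)) (w y)"
  shows "chain w n" and "tableau_of_chain w n (internal_insertion d L i P)"
    and "\<exists>j. w n = add_cell d j (s n)"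
proof -
  from ch obtain r where r: "\<And>k. k < n \<Longrightarrow> s (Suc k) = add_cell d (r k) (s k)"
    unfolding chain_def by metis
  define b where "b = rec_nat i (\<lambda>k bk. if d dvd r k - bk then bk + 1 else bk)"
  have b: "b 0 = i" "b (Suc k) = (if d dvd r k - b k then b k + 1 else b k)" for k
    by (simp_all add: b_def)
  interpret growth_column d L s r b n
    using r b w0 chain_shape[OF ch] by unfold_locales simp_all
  have eq: "s' y = w y" if "y \<le> n" for y
    using that
  proof (induction y)
    case 0
    show ?case by (simp add: s'_def b w0)
  next
    case (Suc y)
    then show ?case using w[of y] s'_local_rule[of y] by simp
  qed
  show "chain w n" using chain_s' eq by (simp add: chain_def)
  show "tableau_of_chain w n (internal_insertion d L i P)"
    using internal_insertion_eq_column[OF P] tableau_of_chain_cong[OF eq] b by simp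
  show "\<exists>j. w n = add_cell d j (s n)" using eq[of n] unfolding s'_def by (metis order_refl)
qed

text \<open>The cell of \<open>Suc k\<close> meets all rows of one class modulo \<open>d\<close>; \<open>row_of\<close> picks the
  representative in \<open>{1..d}\<close>, and any other row of the class yields the same larger shape.\<close>

lemma add_cell_row_of:
  assumes ch: "chain u m" and U: "tableau_of_chain u m U" and k: "k < m"
  shows "u (Suc k) = add_cell d (row_of d L U (Suc k)) (u k)"
proof -
  obtain i where i: "u (Suc k) = add_cell d i (u k)" by (rule chain_step[OF ch k])
  have sh: "u k \<in> shapes d L" "add_cell d i (u k) \<in> shapes d L"
    using chain_shape[OF ch, of k] chain_shape[OF ch, of "Suc k"] k i by auto
  have "(\<exists>j. entry U (cell d L i' j) = Some (Suc k)) \<longleftrightarrow> d dvd i' - i" for i'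
    using U k by (auto simp: tableau_of_chain_def i cell_in_added[OF sh])
  then have "row_of d L U (Suc k) = (THE i'. i' \<in> {1..d} \<and> d dvd i' - i)"
    by (simp add: row_of_def)
  then have "d dvd row_of d L U (Suc k) - i" using theI'[OF ex1_row[of i]] by simp
  then show ?thesis unfolding i by (metis add_cell_cong dvd_diff_commute)
qed

text \<open>After \<open>x\<close> insertions the first tableau has the \<open>x\<close>-th column of the diagram as its chain. Its
  outer shape is the top label of this column, so the second tableau, which records how the outer
  shape grows, has the top boundary up to \<open>x\<close> as its chain.\<close>

lemma CRS_upto_growth_label:
  fixes T U :: tableau
  assumes t: "chain t n" "tableau_of_chain t n T" and u: "chain u m" "tableau_of_chain u m U"
    and corner: "t 0 = u 0" and x: "x \<le> m"
  shows "\<exists>P Q. CRS_upto d L T U x = (P, Q) \<and>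
     chain (growth_label d L T U x) n \<and> tableau_of_chain (growth_label d L T U x) n P \<and>
     chain (\<lambda>x. growth_label d L T U x n) x \<and>
     tableau_of_chain (\<lambda>x. growth_label d L T U x n) x Q"
  using x
proof (induction x)
  case 0
  have left: "growth_label d L T U 0 y = t y" if "y \<le> n" for y
    using that ssh_nth[OF t] by simp
  have "chain (growth_label d L T U 0) n"
    using t(1) left by (simp add: chain_def del: growth_label.simps)
  moreover have "tableau_of_chain (growth_label d L T U 0) n T"
    using t(2) tableau_of_chain_cong[of n "growth_label d L T U 0" t T] left by blast
  moreover have "chain (\<lambda>x. growth_label d L T U x n) 0"
    using left[of n] chain_shape[OF t(1), of n] by (simp add: chain_def del: growth_label.simps)
  moreover have "tableau_of_chain (\<lambda>x. growth_label d L T U x n) 0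
      \<lparr>outer_shape = outer_shape T, inner_shape = outer_shape T, entry = Map.empty\<rparr>"
    using left[of n] t(2) by (simp add: tableau_of_chain_def del: growth_label.simps)
  ultimately show ?case by (simp del: growth_label.simps)
next
  case (Suc x)
  let ?\<rho> = "growth_label d L T U"
  from Suc obtain P Q where PQ: "CRS_upto d L T U x = (P, Q)"
    and P: "chain (?\<rho> x) n" "tableau_of_chain (?\<rho> x) n P"
    and Q: "chain (\<lambda>x. ?\<rho> x n) x" "tableau_of_chain (\<lambda>x. ?\<rho> x n) x Q"
    by auto
  have bottom: "?\<rho> x' 0 = u x'" if "x' \<le> m" for x'
  proof (cases x')
    case 0
    then show ?thesis using corner ssh_nth[OF t] by simp
  next
    case (Suc z)
    then show ?thesis using that ssh_nth[OF u] by simp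
  qed
  let ?i = "row_of d L U (Suc x)"
  let ?P = "internal_insertion d L ?i P"
  have "?\<rho> (Suc x) 0 = add_cell d ?i (?\<rho> x 0)" "?\<rho> (Suc x) 0 \<in> shapes d L"
    using bottom[of x] bottom[of "Suc x"] add_cell_row_of[OF u, of x]
      chain_shape[OF u(1), of "Suc x"] Suc.prems
    by (simp_all del: growth_label.simps)
  note column = internal_insertion_column[OF P this growth_label.simps(3)]
  let ?top = "\<lambda>x. ?\<rho> x n"
  have top: "chain ?top (Suc x)"
    using Q(1) column(1,3) by (auto simp: chain_def le_Suc_eq less_Suc_eq simp del: growth_label.simps)
  then obtain c where c: "skew d L (?top (Suc x)) (?top x) = {c}"
    using chain_step_cell[OF top, of x] by blast
  have outer: "outer_shape ?P = ?top (Suc x)" "outer_shape P = ?top x"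
    using column(2) P(2) by (auto simp: tableau_of_chain_def)
  have "CRS_upto d L T U (Suc x) =
      (?P, Q\<lparr>outer_shape := ?top (Suc x), entry := (entry Q)(c \<mapsto> Suc x)\<rparr>)"
    using PQ c outer by (simp add: Let_def)
  moreover have "tableau_of_chain ?top (Suc x)
      (Q\<lparr>outer_shape := ?top (Suc x), entry := (entry Q)(c \<mapsto> Suc x)\<rparr>)"
    by (rule tableau_of_chain_extend[OF top Q(2)]) (simp add: c)
  ultimately show ?case using column(1,2) top by blast
qed

end

theorem theorem5p2:
  fixes d L :: int and \<mu> \<alpha> \<beta> :: shape and T U P Q P' Q' :: tableau
  assumes "d \<ge> 1" and "L \<ge> 1"
    and "\<mu> \<in> shapes d L" and "\<alpha> \<in> shapes d L" and "\<beta> \<in> shapes d L"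
    and "\<mu> \<le> \<alpha>" and "\<mu> \<le> \<beta>"
    and "T \<in> SCT d L \<alpha> \<mu>" and "U \<in> SCT d L \<beta> \<mu>"
    and "growth_map d L T U = (P', Q')"
    and "CRS d L T U = (P, Q)"
  shows "(P', Q') = (P, Q)"
proof -
  interpret cylinder d L using assms(1,2) by unfold_locales
  obtain t n where t: "chain t n" "tableau_of_chain t n T"
    using SCT_imp_chain[OF assms(4,3,6,8) refl] by blast
  obtain u m where u: "chain u m" "tableau_of_chain u m U"
    using SCT_imp_chain[OF assms(5,3,7,9) refl] by blast
  have inner: "inner_shape T = \<mu>" "inner_shape U = \<mu>"
    using assms(8,9) unfolding SCT_def by blast+
  then have corner: "t 0 = u 0"
    using t(2) u(2) by (simp add: tableau_of_chain_def)
  have size: "num_cells d T = n" "num_cells d U = m"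
    using tableau_of_chain_num_cells t u by auto
  let ?\<rho> = "growth_label d L T U"
  let ?top = "\<lambda>x. ?\<rho> x n"
  have P: "chain (?\<rho> m) n" "tableau_of_chain (?\<rho> m) n P"
    and Q: "chain ?top m" "tableau_of_chain ?top m Q"
    using CRS_upto_growth_label[OF t u corner order_refl] assms(11) size by (auto simp: CRS_def)
  have "?top 0 = outer_shape T"
    using ssh_nth[OF t] t(2) by (simp add: tableau_of_chain_def)
  moreover have "?\<rho> m 0 = outer_shape U"
    using ssh_nth[OF t] ssh_nth[OF u] u(2) corner
    by (cases m) (simp_all add: tableau_of_chain_def)
  ultimately have "growth_map d L T U =
      (THE P. P \<in> SCT d L (?\<rho> m n) (?\<rho> m 0) \<and> ssh d L P = map (?\<rho> m) [0..<Suc n],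
       THE Q. Q \<in> SCT d L (?top m) (?top 0) \<and> ssh d L Q = map ?top [0..<Suc m])"
    by (simp only: growth_map_def Let_def size)
  also have "\<dots> = (P, Q)"
    using SCT_determined_by_ssh[OF P] SCT_determined_by_ssh[OF Q] by simp
  finally show ?thesis using assms(10) by simp
qed

end
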